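(* Fix a tree partition of $\omega$ with associated ideals $\mathcal H_n$ and $\mathcal H_{<\omega}=\bigcup_n\mathcal H_n$. Let $N\ge2$ and let $\xi_1,\dots,\xi_N:\omega\to\omega$ be such that for every $k$ with $1\le k\le N$ the window $q_k=(\xi_k,\xi_{k-1},\dots,\xi_1):\omega\to\omega^k$ witnesses $\mathrm{Fin}^{\otimes k}\le_K\mathcal H_{<\omega}$. Let $m\ge1$ and suppose that all graph tests of the pair $(\xi_2,\xi_1)$ lie in $\mathcal H_m$, i.e. $\{x\in\omega:\xi_1(x)\le h(\xi_2(x))\}\in\mathcal H_m$ for every $h:\omega\to\omega$. Then $N\le m+1$. In particular, the pair $(\xi_2,\xi_1)$ does not extend to a coherent window of length $m+2$, i.e. to a sequence $(\xi_{m+2},\dots,\xi_1)$ all of whose windows $q_k$ ($k\le m+2$) witness $\mathrm{Fin}^{\otimes k}\le_K\mathcal H_{<\omega}$.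
   Context: A tree partition of $\omega$ is a family $\langle A_s:s\in\omega^{<\omega}\rangle$ of infinite subsets of $\omega$ such that $A_\varnothing=\omega$, for each $s$ the family $\{A_{s^\frown n}:n\in\omega\}$ is a partition of $A_s$, and any two distinct points of $\omega$ lie in different cells $A_s\neq A_t$ with $|s|=|t|=n$ for some $n$. For $X\subseteq\omega$ let $T^\infty_X=\{s\in\omega^{<\omega}:X\cap A_s\text{ is infinite}\}$. For $T\subseteq\omega^{<\omega}$ put $\mathrm{Succ}_T(s)=\{n:s^\frown n\in T\}$ and $D(T)=\{s\in T:\mathrm{Succ}_T(s)\text{ is infinite}\}$; $D^0(T)=T$, $D^{n+1}(T)=D(D^n(T))$. For $n<\omega$, $\mathcal H_n=\{X\subseteq\omega:\varnothing\notin D^n(T^\infty_X)\}$ (an ideal on $\omega$). $\mathrm{Fin}$ is the ideal of finite subsets of $\omega$; $\mathrm{Fin}^{\otimes1}=\mathrm{Fin}$, and $\mathrm{Fin}^{\otimes(k+1)}$ is the ideal on $\omega^{k+1}$ of all $C$ such that for all but finitely many $n$ the section $\{t\in\omega^k:(n)^\frown t\in C\}$ belongs to $\mathrm{Fin}^{\otimes k}$ (first coordinate outermost). A map $q:\omega\to\omega^k$ witnesses $\mathrm{Fin}^{\otimes k}\le_K\mathcal H_{<\omega}$ if $q^{-1}[B]\in\mathcal H_{<\omega}$ for every $B\in\mathrm{Fin}^{\otimes k}$. *)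

theory Defs
  imports Main "HOL-Library.Disjoint_Sets"
begin

text \<open>Finite sequences of natural numbers are lists; the one-point extension of \<open>s\<close> by \<open>n\<close>
  is \<open>s @ [n]\<close>.\<close>

definition tree_partition :: "(nat list \<Rightarrow> nat set) \<Rightarrow> bool" where
  "tree_partition A \<longleftrightarrow>
     (\<forall>s. infinite (A s)) \<and>
     A [] = UNIV \<and>
     (\<forall>s. (\<Union>n. A (s @ [n])) = A s \<and> disjoint_family (\<lambda>n. A (s @ [n]))) \<and>
     (\<forall>x y. x \<noteq> y \<longrightarrow>
        (\<exists>n s t. length s = n \<and> length t = n \<and> A s \<noteq> A t \<and> x \<in> A s \<and> y \<in> A t))"

definition T_inf :: "(nat list \<Rightarrow> nat set) \<Rightarrow> nat set \<Rightarrow> nat list set" where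
  "T_inf A X = {s. infinite (X \<inter> A s)}"

definition Succ_in :: "nat list set \<Rightarrow> nat list \<Rightarrow> nat set" where
  "Succ_in T s = {n. s @ [n] \<in> T}"

definition D :: "nat list set \<Rightarrow> nat list set" where
  "D T = {s \<in> T. infinite (Succ_in T s)}"

definition H :: "(nat list \<Rightarrow> nat set) \<Rightarrow> nat \<Rightarrow> nat set set" where
  "H A n = {X. [] \<notin> (D ^^ n) (T_inf A X)}"

definition H_fin :: "(nat list \<Rightarrow> nat set) \<Rightarrow> nat set set" where
  "H_fin A = (\<Union>n. H A n)"

text \<open>Elements of \<open>\<omega>\<^sup>k\<close> are lists of length \<open>k\<close>, the head being the first (outermost)
  coordinate. Only exponents \<open>k \<ge> 1\<close> are meaningful; the value at \<open>0\<close> is a dummy.\<close>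

fun Fin_pow :: "nat \<Rightarrow> nat list set set" where
  "Fin_pow 0 = {{}}"
| "Fin_pow (Suc 0) = {C. C \<subseteq> {t. length t = 1} \<and> finite C}"
| "Fin_pow (Suc (Suc k)) =
     {C. C \<subseteq> {t. length t = Suc (Suc k)} \<and>
         finite {n. {t. length t = Suc k \<and> n # t \<in> C} \<notin> Fin_pow (Suc k)}}"

definition witnesses_Katetov :: "(nat list \<Rightarrow> nat set) \<Rightarrow> nat \<Rightarrow> (nat \<Rightarrow> nat list) \<Rightarrow> bool" where
  "witnesses_Katetov A k q \<longleftrightarrow>
     (\<forall>x. length (q x) = k) \<and> (\<forall>B \<in> Fin_pow k. q -` B \<in> H_fin A)"

text \<open>The window \<open>(\<xi>\<^sub>k, \<dots>, \<xi>\<^sub>1)\<close>, with decreasing indices.\<close>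

definition window :: "(nat \<Rightarrow> nat \<Rightarrow> nat) \<Rightarrow> nat \<Rightarrow> nat \<Rightarrow> nat list" where
  "window \<xi> k x = map (\<lambda>i. \<xi> i x) (rev [1..<Suc k])"

text \<open>Only the values of \<open>\<xi>\<close> at the indices \<open>1, \<dots>, N\<close> matter.\<close>

definition coherent_window :: "(nat list \<Rightarrow> nat set) \<Rightarrow> nat \<Rightarrow> (nat \<Rightarrow> nat \<Rightarrow> nat) \<Rightarrow> bool" where
  "coherent_window A N \<xi> \<longleftrightarrow> (\<forall>k \<in> {1..N}. witnesses_Katetov A k (window \<xi> k))"

end

theory Submission
  imports Defs "HOL-Library.Countable" "HOL-Library.Infinite_Set"
begin

text \<open>
  Call a set \<open>X\<close> positive at a node \<open>s\<close> if for every \<open>n\<close> there are infinitely many \<open>i\<^sub>1\<close>, for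
  each of them infinitely many \<open>i\<^sub>2\<close>, and so on up to \<open>i\<^sub>n\<close>, such that \<open>X\<close> meets the cell of
  \<open>s i\<^sub>1 \<dots> i\<^sub>n\<close> in an infinite set. The same quantifier of length exactly \<open>n\<close> at the root
  describes the complement of the ideal \<open>\<H>\<^sub>n\<close>, so positivity at the root is the complement of the
  union of these ideals. Below, "many nodes" of a given length refers to this quantifier. If \<open>X\<close>
  is positive at infinitely many children of \<open>s\<close>, then it is positive at \<open>s\<close>.

  Two facts give the bound.

  First, suppose that all graph tests of \<open>(\<xi>\<^sub>2, \<xi>\<^sub>1)\<close> lie in \<open>\<H>\<^sub>m\<close>. Then \<open>\<xi>\<^sub>2\<close> is bounded on
  the cells of many nodes of length \<open>m\<close>
  (\<open>often_bounded_of_graph_tests\<close>). On a cell where \<open>\<xi>\<^sub>2\<close> is unbounded, some \<open>h\<close> makes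
  \<open>\<xi>\<^sub>1 \<le> h(\<xi>\<^sub>2)\<close> hold at points with arbitrarily large \<open>\<xi>\<^sub>2\<close>. There are countably many
  nodes, and one function eventually dominates all the functions \<open>h\<close> chosen for them. At points
  where \<open>\<xi>\<^sub>2\<close> is large enough, the dominating function passes every test that \<open>h\<close> passes. So if
  there were many such cells, a single graph test would be infinite on many of them
  (\<open>often_uniform_graph_test\<close>).

  Second, boundedness moves towards the root at the price of one function of the sequence
  (\<open>not_often_bounded\<close>). Suppose that \<open>X\<close> is positive, and \<open>\<xi>\<^sub>k\<close> bounded on it, at infinitely
  many children of \<open>s\<close>. Then either \<open>X\<close> remains positive at \<open>s\<close> after being cut down to a set
  on which \<open>\<xi>\<^sub>k\<^sub>+\<^sub>1\<close> is bounded, or a graph test of \<open>(\<xi>\<^sub>k\<^sub>+\<^sub>1, \<xi>\<^sub>k)\<close> is positive at \<open>s\<close>, in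
  the same robust form as above. The second alternative cannot hold at many nodes \<open>s\<close>, because
  domination would then make one graph test positive at the root, against coherence. So the first
  one holds at many nodes, one level higher.

  If the window had length at least \<open>m + 2\<close>, then the first fact and \<open>m\<close> applications of the
  second one would produce a set that is positive at the root and on which \<open>\<xi>\<^sub>m\<^sub>+\<^sub>2\<close> is bounded.
  This contradicts coherence.
\<close>

section \<open>Iterated infinite quantifiers along the tree\<close>

text \<open>The sequences \<open>u\<close> of length \<open>m\<close> with \<open>P (s @ u)\<close> form a positive set for the
  \<open>m\<close>-th Fubini power of the ideal of finite sets. Recursion from the root outwards matches
  both the derivative \<open>D\<close> and the step from the children of a node to the node.\<close>

primrec often :: "nat \<Rightarrow> (nat list \<Rightarrow> bool) \<Rightarrow> nat list \<Rightarrow> bool" where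
  "often 0 P s \<longleftrightarrow> P s"
| "often (Suc m) P s \<longleftrightarrow> (\<exists>\<^sub>\<infinity>n. often m P (s @ [n]))"

lemma often_mono:
  assumes "often m P s" and "\<And>u. length u = m \<Longrightarrow> P (s @ u) \<Longrightarrow> Q (s @ u)"
  shows "often m Q s"
  using assms
proof (induction m arbitrary: s)
  case 0
  then show ?case using "0.prems"(2)[of "[]"] by simp
next
  case (Suc m)
  have "often m Q (s @ [n])" if "often m P (s @ [n])" for n
    using Suc.IH[OF that] Suc.prems(2)[of "n # _"] by simp
  with Suc.prems(1) show ?case
    by (auto elim: INFM_mono)
qed

lemma often_disj:
  "often m (\<lambda>t. P t \<or> Q t) s \<Longrightarrow> often m P s \<or> often m Q s"
proof (induction m arbitrary: s)
  case (Suc m)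
  from Suc.prems have "\<exists>\<^sub>\<infinity>n. often m (\<lambda>t. P t \<or> Q t) (s @ [n])" by simp
  then have "\<exists>\<^sub>\<infinity>n. often m P (s @ [n]) \<or> often m Q (s @ [n])"
    by (rule INFM_mono) (rule Suc.IH)
  then show ?case by (simp add: INFM_disj_distrib)
qed simp

lemma often_True: "(\<And>t. P t) \<Longrightarrow> often m P s"
  by (induction m arbitrary: s) (simp_all add: INFM_const)

text \<open>The innermost quantifier ranges over the children of a node of length \<open>m\<close>; this is the
  quantifier that the inductive argument removes.\<close>

lemma often_Suc_inner: "often (Suc m) P s \<longleftrightarrow> often m (\<lambda>t. \<exists>\<^sub>\<infinity>n. P (t @ [n])) s"
proof (induction m arbitrary: s)
  case (Suc m)
  show ?case
    by (subst often.simps(2)) (simp only: Suc.IH often.simps(2)[of m "\<lambda>t. \<exists>\<^sub>\<infinity>n. P (t @ [n])"])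
qed simp

text \<open>Diagonalise along an enumeration: at \<open>i\<close>, take the largest value of the first functions
  up to index \<open>i\<close>.\<close>

lemma eventual_domination:
  fixes F :: "'a::countable \<Rightarrow> nat \<Rightarrow> nat"
  shows "\<exists>h. \<forall>a. \<exists>c. \<forall>i\<ge>c. F a i \<le> h i"
proof (intro exI allI impI)
  fix a :: 'a and i :: nat
  assume "to_nat a \<le> i"
  then show "F a i \<le> Max ((\<lambda>j. F (from_nat j) i) ` {..i})"
    by (intro Max_ge) (auto intro!: image_eqI[of _ _ "to_nat a"])
qed

text \<open>The test functions found at different nodes are replaced by one that dominates all of them
  eventually. At each node, domination can fail only at points where \<open>g\<close> takes one of finitely many
  values; asking that \<open>Q\<close> survive every cut \<open>c \<le> g x\<close> makes such points irrelevant.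
  In the applications \<open>Q\<close> is either infinity on a cell or positivity at a node.\<close>

lemma often_uniform_graph_test:
  fixes f g :: "'a \<Rightarrow> nat"
  assumes often: "often m (\<lambda>t. \<exists>h. \<forall>c. Q {x. f x \<le> h (g x) \<and> c \<le> g x} t) s"
    and mono: "\<And>X Y t. X \<subseteq> Y \<Longrightarrow> Q X t \<Longrightarrow> Q Y t"
  shows "\<exists>h. often m (Q {x. f x \<le> h (g x)}) s"
proof -
  define F where "F t = (SOME h. \<forall>c. Q {x. f x \<le> h (g x) \<and> c \<le> g x} t)" for t
  obtain h where h: "\<And>t. \<exists>c. \<forall>i\<ge>c. F t i \<le> h i"
    using eventual_domination[of F] by blast
  have "Q {x. f x \<le> h (g x)} t"
    if ex: "\<exists>h. \<forall>c. Q {x. f x \<le> h (g x) \<and> c \<le> g x} t" for t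
  proof -
    have F: "\<forall>c. Q {x. f x \<le> F t (g x) \<and> c \<le> g x} t"
      unfolding F_def using ex by (rule someI_ex)
    obtain c where "\<forall>i\<ge>c. F t i \<le> h i" using h by blast
    then have "{x. f x \<le> F t (g x) \<and> c \<le> g x} \<subseteq> {x. f x \<le> h (g x)}"
      using order_trans by blast
    with F mono show ?thesis by blast
  qed
  with often have "often m (Q {x. f x \<le> h (g x)}) s"
    by (blast intro: often_mono[OF often])
  then show ?thesis by blast
qed

section \<open>Positivity at a node\<close>

locale tree_of_cells =
  fixes A :: "nat list \<Rightarrow> nat set"
  assumes tree_partition: "tree_partition A"
begin

definition infinite_in :: "nat set \<Rightarrow> nat list \<Rightarrow> bool" where
  "infinite_in X t \<longleftrightarrow> infinite (X \<inter> A t)"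

definition pos :: "nat set \<Rightarrow> nat list \<Rightarrow> bool" where
  "pos X s \<longleftrightarrow> (\<forall>n. often n (infinite_in X) s)"

lemma cell_infinite: "infinite (A s)"
  and cell_root: "A [] = UNIV"
  and cell_child_subset: "A (s @ [n]) \<subseteq> A s"
  and cell_child_disjoint: "i \<noteq> j \<Longrightarrow> A (s @ [i]) \<inter> A (s @ [j]) = {}"
proof -
  show "infinite (A s)" "A [] = UNIV"
    using tree_partition unfolding tree_partition_def by blast+
  show "A (s @ [n]) \<subseteq> A s"
    using tree_partition unfolding tree_partition_def by blast
  show "i \<noteq> j \<Longrightarrow> A (s @ [i]) \<inter> A (s @ [j]) = {}"
    using tree_partition unfolding tree_partition_def disjoint_family_on_def by auto
qed

lemma cell_disjoint:
  "length s = length t \<Longrightarrow> s \<noteq> t \<Longrightarrow> A s \<inter> A t = {}"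
proof (induction s arbitrary: t rule: rev_induct)
  case (snoc i s)
  then obtain t' j where t: "t = t' @ [j]" by (cases t rule: rev_cases) auto
  show ?case
  proof (cases "s = t'")
    case True
    then show ?thesis using snoc.prems t cell_child_disjoint by simp
  next
    case False
    then have "A s \<inter> A t' = {}" using snoc t by simp
    then show ?thesis using cell_child_subset t by blast
  qed
qed simp

lemma infinite_in_mono: "infinite_in X s \<Longrightarrow> X \<inter> A s \<subseteq> Y \<Longrightarrow> infinite_in Y s"
  unfolding infinite_in_def by (meson Int_lower2 Int_subset_iff finite_subset)

lemma infinite_in_parent: "infinite_in X (s @ [n]) \<Longrightarrow> infinite_in X s"
  unfolding infinite_in_def by (meson Int_mono cell_child_subset finite_subset order_refl)

lemma often_infinite_in_mono:
  "often n (infinite_in X) s \<Longrightarrow> X \<inter> A s \<subseteq> Y \<Longrightarrow> often n (infinite_in Y) s"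
proof (induction n arbitrary: s)
  case (Suc n)
  have "often n (infinite_in Y) (s @ [k])" if "often n (infinite_in X) (s @ [k])" for k
    using that Suc.prems(2) cell_child_subset by (blast intro: Suc.IH)
  with Suc.prems(1) show ?case by (auto elim: INFM_mono)
qed (simp add: infinite_in_mono)

text \<open>An infinite trace on a child cell is an infinite trace on the parent cell, so the last of the
  iterated quantifiers may be dropped. This says that the ideals \<open>\<H>\<^sub>n\<close> increase with \<open>n\<close>.\<close>

lemma often_infinite_in_Suc:
  "often (Suc n) (infinite_in X) s \<Longrightarrow> often n (infinite_in X) s"
proof (induction n arbitrary: s)
  case 0
  then show ?case by (auto dest!: INFM_EX intro: infinite_in_parent)
next
  case (Suc n)
  from Suc.prems have "\<exists>\<^sub>\<infinity>k. often (Suc n) (infinite_in X) (s @ [k])"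
    by simp
  then have "\<exists>\<^sub>\<infinity>k. often n (infinite_in X) (s @ [k])"
    by (rule INFM_mono) (rule Suc.IH)
  then show ?case by simp
qed

lemma often_infinite_in_antimono:
  "often n (infinite_in X) s \<Longrightarrow> k \<le> n \<Longrightarrow> often k (infinite_in X) s"
  by (induction n arbitrary: k)
    (use le_SucE often_infinite_in_Suc in \<open>blast+\<close>)

text \<open>Membership in \<open>D T\<close> demands membership in \<open>T\<close> besides infinitely many successors in \<open>T\<close>;
  for the iterates starting from \<open>T_inf A X\<close> the former follows from the latter.\<close>

lemma funpow_D_T_inf: "(D ^^ n) (T_inf A X) = {s. often n (infinite_in X) s}"
proof (induction n)
  case 0
  then show ?case by (simp add: T_inf_def infinite_in_def)
next
  case (Suc n)
  have "(D ^^ Suc n) (T_inf A X)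
      = {s. often n (infinite_in X) s \<and> often (Suc n) (infinite_in X) s}"
    by (simp add: Suc.IH D_def Succ_in_def INFM_iff_infinite)
  then show ?case using often_infinite_in_Suc by blast
qed

lemma H_iff: "X \<in> H A n \<longleftrightarrow> \<not> often n (infinite_in X) []"
  by (simp add: H_def funpow_D_T_inf)

lemma H_fin_iff: "X \<in> H_fin A \<longleftrightarrow> \<not> pos X []"
  by (simp add: H_fin_def H_iff pos_def)

lemma pos_mono: "pos X s \<Longrightarrow> X \<inter> A s \<subseteq> Y \<Longrightarrow> pos Y s"
  unfolding pos_def by (blast intro: often_infinite_in_mono)

lemma pos_UNIV: "pos UNIV s"
  unfolding pos_def by (simp add: often_True infinite_in_def cell_infinite)

text \<open>If neither set is positive, the ranks at which they fail may differ; the ideals increase,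
  so both fail at the larger one, where the iterated quantifier splits over the disjunction.\<close>

lemma pos_Un: "pos (X \<union> Y) s \<Longrightarrow> pos X s \<or> pos Y s"
proof (rule ccontr)
  assume XY: "pos (X \<union> Y) s" and "\<not> (pos X s \<or> pos Y s)"
  then obtain i j where "\<not> often i (infinite_in X) s" "\<not> often j (infinite_in Y) s"
    by (auto simp: pos_def)
  then have "\<not> often (max i j) (infinite_in X) s" "\<not> often (max i j) (infinite_in Y) s"
    using often_infinite_in_antimono by (meson max.cobounded1 max.cobounded2)+
  moreover have "often (max i j) (\<lambda>t. infinite_in X t \<or> infinite_in Y t) s"
    using XY unfolding pos_def infinite_in_def by (simp add: Int_Un_distrib2)
  ultimately show False using often_disj by blast
qed

lemma pos_step:
  assumes "\<exists>\<^sub>\<infinity>n. pos X (s @ [n])"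
  shows "pos X s"
  unfolding pos_def
proof
  fix k
  have "often (Suc k) (infinite_in X) s"
    using assms by (auto elim!: INFM_mono simp: pos_def)
  then show "often k (infinite_in X) s" by (rule often_infinite_in_Suc)
qed

lemma pos_often: "often m (pos X) s \<Longrightarrow> pos X s"
proof (induction m arbitrary: s)
  case (Suc m)
  from Suc.prems have "\<exists>\<^sub>\<infinity>n. often m (pos X) (s @ [n])" by simp
  then have "\<exists>\<^sub>\<infinity>n. pos X (s @ [n])" by (rule INFM_mono) (rule Suc.IH)
  then show ?case by (rule pos_step)
qed simp

section \<open>Moving boundedness towards the root\<close>

text \<open>Suppose that no set \<open>X \<inter> {x. g x < c}\<close> is positive at \<open>s\<close>. Then each of them is positive
  at only finitely many children, so for every \<open>c\<close> the part of \<open>X\<close> with \<open>c \<le> g x\<close> is positive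
  at some late child, on whose cell \<open>f\<close> is bounded on \<open>X\<close>. If \<open>h(i)\<close> is at least every bound found for
  \<open>c \<le> i\<close>, then \<open>f \<le> h(g)\<close> holds on each of these parts.\<close>

lemma graph_test_or_bounded:
  fixes f g :: "nat \<Rightarrow> nat"
  assumes inf: "\<exists>\<^sub>\<infinity>n. pos X (s @ [n]) \<and> (\<exists>b. \<forall>x \<in> X \<inter> A (s @ [n]). f x \<le> b)"
  shows "(\<exists>c. pos (X \<inter> {x. g x < c}) s) \<or>
    (\<exists>h. \<forall>c. pos {x. f x \<le> h (g x) \<and> c \<le> g x} s)"
proof (rule disjCI)
  assume "\<not> (\<exists>h. \<forall>c. pos {x. f x \<le> h (g x) \<and> c \<le> g x} s)"
  show "\<exists>c. pos (X \<inter> {x. g x < c}) s"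
  proof (rule ccontr)
    assume no: "\<not> (\<exists>c. pos (X \<inter> {x. g x < c}) s)"
    have "\<exists>n b. c \<le> n \<and> pos (X \<inter> {x. c \<le> g x}) (s @ [n]) \<and> (\<forall>x \<in> X \<inter> A (s @ [n]). f x \<le> b)"
      for c
    proof -
      have "\<not> (\<exists>\<^sub>\<infinity>n. pos (X \<inter> {x. g x < c}) (s @ [n]))"
        using no pos_step by blast
      then have "\<forall>\<^sub>\<infinity>n. \<not> pos (X \<inter> {x. g x < c}) (s @ [n])"
        by simp
      moreover have "\<forall>\<^sub>\<infinity>n. c \<le> n" by (auto simp: MOST_nat_le)
      ultimately have "\<forall>\<^sub>\<infinity>n. \<not> pos (X \<inter> {x. g x < c}) (s @ [n]) \<and> c \<le> n"
        by (rule MOST_conjI)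
      from INFM_conjI[OF inf this] obtain n b where
        n: "pos X (s @ [n])" "\<forall>x \<in> X \<inter> A (s @ [n]). f x \<le> b"
          "\<not> pos (X \<inter> {x. g x < c}) (s @ [n])" "c \<le> n"
        by (auto dest!: INFM_EX)
      have "X = (X \<inter> {x. g x < c}) \<union> (X \<inter> {x. c \<le> g x})" by auto
      with n(1,3) have "pos (X \<inter> {x. c \<le> g x}) (s @ [n])" using pos_Un by metis
      with n show ?thesis by blast
    qed
    then obtain n b where nb: "\<And>c. c \<le> n c" "\<And>c. pos (X \<inter> {x. c \<le> g x}) (s @ [n c])"
      "\<And>c. \<forall>x \<in> X \<inter> A (s @ [n c]). f x \<le> b c"
      by metis
    define h where "h i = Max (b ` {..i})" for i
    have "pos {x. f x \<le> h (g x) \<and> c \<le> g x} s" for c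
    proof (rule pos_step, unfold INFM_nat_le, intro allI)
      fix k
      let ?d = "max c k"
      have "pos {x. f x \<le> h (g x) \<and> c \<le> g x} (s @ [n ?d])"
      proof (rule pos_mono[OF nb(2)], safe)
        fix x assume x: "x \<in> X" "x \<in> A (s @ [n ?d])" "?d \<le> g x"
        then have "f x \<le> b ?d" using nb(3) by blast
        also have "\<dots> \<le> h (g x)" unfolding h_def using x(3) by (intro Max_ge) auto
        finally show "f x \<le> h (g x)" .
        show "c \<le> g x" using x(3) by simp
      qed
      then show "\<exists>j\<ge>k. pos {x. f x \<le> h (g x) \<and> c \<le> g x} (s @ [j])"
        using nb(1)[of ?d] by (intro exI[of _ "n ?d"]) simp
    qed
    with \<open>\<not> (\<exists>h. \<forall>c. _ h c)\<close> show False by blast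
  qed
qed

text \<open>Induction on the level \<open>m\<close> at which \<open>\<zeta> 0\<close> is bounded. The set \<open>X\<close> has to vary, since each
  step replaces it by a subset on whose part in each cell of level one less the next function
  is bounded.\<close>

lemma not_often_bounded:
  fixes \<zeta> :: "nat \<Rightarrow> nat \<Rightarrow> nat"
  assumes graph: "\<And>k h. k < m \<Longrightarrow> \<not> pos {x. \<zeta> k x \<le> h (\<zeta> (Suc k) x)} []"
    and last: "\<And>c. \<not> pos {x. \<zeta> m x \<le> c} []"
  shows "\<not> often m (\<lambda>t. pos X t \<and> (\<exists>b. \<forall>x \<in> X \<inter> A t. \<zeta> 0 x \<le> b)) []"
  using assms
proof (induction m arbitrary: \<zeta> X)
  case 0
  show ?case
  proof
    assume "often 0 (\<lambda>t. pos X t \<and> (\<exists>b. \<forall>x \<in> X \<inter> A t. \<zeta> 0 x \<le> b)) []"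
    then obtain b where "pos X []" "\<forall>x \<in> X \<inter> A []. \<zeta> 0 x \<le> b" by auto
    then have "pos {x. \<zeta> 0 x \<le> b} []" by (auto elim!: pos_mono)
    with "0.prems"(2) show False by blast
  qed
next
  case (Suc m)
  show ?case
  proof
    assume "often (Suc m) (\<lambda>t. pos X t \<and> (\<exists>b. \<forall>x \<in> X \<inter> A t. \<zeta> 0 x \<le> b)) []"
    then have "often m (\<lambda>s. (\<exists>c. pos (X \<inter> {x. \<zeta> 1 x < c}) s) \<or>
        (\<exists>h. \<forall>c. pos {x. \<zeta> 0 x \<le> h (\<zeta> 1 x) \<and> c \<le> \<zeta> 1 x} s)) []"
      unfolding often_Suc_inner
      by (rule often_mono) (rule graph_test_or_bounded)
    then consider
        (bounded) "often m (\<lambda>s. \<exists>c. pos (X \<inter> {x. \<zeta> 1 x < c}) s) []"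
      | (graph) "often m (\<lambda>s. \<exists>h. \<forall>c. pos {x. \<zeta> 0 x \<le> h (\<zeta> 1 x) \<and> c \<le> \<zeta> 1 x} s) []"
      by (rule often_disj[THEN disjE]) blast+
    then show False
    proof cases
      case graph
      then have "\<exists>h. often m (pos {x. \<zeta> 0 x \<le> h (\<zeta> 1 x)}) []"
        by (rule often_uniform_graph_test) (blast intro: pos_mono)
      with Suc.prems(1)[of 0] pos_often show False by auto
    next
      case bounded
      \<comment> \<open>The bounds vary with the node. The cells of one level are disjoint, so cutting \<open>X\<close>
        separately on each of them yields a single set.\<close>
      define C where "C s = (SOME c. pos (X \<inter> {x. \<zeta> 1 x < c}) s)" for s
      define Y where "Y = (\<Union>s \<in> {s. length s = m}. X \<inter> {x. \<zeta> 1 x < C s} \<inter> A s)"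
      have "often m (\<lambda>t. pos Y t \<and> (\<exists>b. \<forall>x \<in> Y \<inter> A t. \<zeta> 1 x \<le> b)) []"
      proof (rule often_mono[OF bounded])
        fix u :: "nat list"
        assume len: "length u = m"
          and ex: "\<exists>c. pos (X \<inter> {x. \<zeta> 1 x < c}) ([] @ u)"
        have "pos (X \<inter> {x. \<zeta> 1 x < C u}) u"
          using someI_ex[OF ex] by (simp add: C_def)
        then have "pos Y u" by (rule pos_mono) (use len in \<open>auto simp: Y_def\<close>)
        moreover have "\<zeta> 1 x \<le> C u" if "x \<in> Y \<inter> A u" for x
        proof -
          from that obtain s where s: "length s = m" "\<zeta> 1 x < C s" "x \<in> A s" "x \<in> A u"
            by (auto simp: Y_def)
          then have "s = u" using cell_disjoint[of s u] len by auto
          with s show ?thesis by simp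
        qed
        ultimately show "pos Y ([] @ u) \<and> (\<exists>b. \<forall>x \<in> Y \<inter> A ([] @ u). \<zeta> 1 x \<le> b)"
          by auto
      qed
      moreover have "\<not> often m (\<lambda>t. pos Y t \<and> (\<exists>b. \<forall>x \<in> Y \<inter> A t. \<zeta> (Suc 0) x \<le> b)) []"
        by (rule Suc.IH) (use Suc.prems in auto)
      ultimately show False by simp
    qed
  qed
qed

text \<open>On a cell where \<open>g\<close> is unbounded, choose points \<open>p c\<close> with \<open>c \<le> g (p c)\<close> and let
  \<open>h(i)\<close> bound the values \<open>f (p c)\<close> for \<open>c \<le> i\<close>. All these points pass the test for \<open>h\<close>,
  and \<open>g\<close> is unbounded on them.\<close>

lemma often_bounded_of_graph_tests:
  fixes f g :: "nat \<Rightarrow> nat"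
  assumes "\<And>h. {x. f x \<le> h (g x)} \<in> H A m"
  shows "often m (\<lambda>t. \<exists>b. \<forall>x \<in> A t. g x \<le> b) []"
proof (rule ccontr)
  assume "\<not> often m (\<lambda>t. \<exists>b. \<forall>x \<in> A t. g x \<le> b) []"
  moreover have "often m (\<lambda>t. \<exists>b. \<forall>x \<in> A t. g x \<le> b) []
      \<or> often m (\<lambda>t. \<not> (\<exists>b. \<forall>x \<in> A t. g x \<le> b)) []"
    by (rule often_disj, rule often_True) blast
  ultimately have "often m (\<lambda>t. \<not> (\<exists>b. \<forall>x \<in> A t. g x \<le> b)) []"
    by blast
  then have "often m (\<lambda>t. \<exists>h. \<forall>c. infinite_in {x. f x \<le> h (g x) \<and> c \<le> g x} t) []"
  proof (rule often_mono)
    fix u :: "nat list"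
    assume unb: "\<not> (\<exists>b. \<forall>x \<in> A ([] @ u). g x \<le> b)"
    then have "\<exists>x. x \<in> A u \<and> c \<le> g x" for c
      by (metis append_Nil nat_le_linear)
    then obtain p where p: "\<And>c. p c \<in> A u" "\<And>c. c \<le> g (p c)" by metis
    define h where "h i = Max ((\<lambda>c. f (p c)) ` {..i})" for i
    have "infinite_in {x. f x \<le> h (g x) \<and> c \<le> g x} u" for c
    proof -
      let ?Z = "{x. f x \<le> h (g x) \<and> c \<le> g x} \<inter> A u"
      have in_Z: "p d \<in> ?Z" if "c \<le> d" for d
      proof -
        have "f (p d) \<le> h (g (p d))"
          unfolding h_def by (rule Max_ge) (use p(2)[of d] in auto)
        then show ?thesis using p[of d] that by simp
      qed
      have "infinite (g ` ?Z)"
        unfolding infinite_nat_iff_unbounded_le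
      proof
        fix k
        show "\<exists>i\<ge>k. i \<in> g ` ?Z"
          using in_Z[of "max c k"] p(2)[of "max c k"] by (intro exI[of _ "g (p (max c k))"]) auto
      qed
      then show ?thesis unfolding infinite_in_def by blast
    qed
    then show "\<exists>h. \<forall>c. infinite_in {x. f x \<le> h (g x) \<and> c \<le> g x} ([] @ u)"
      by auto
  qed
  then have "\<exists>h. often m (infinite_in {x. f x \<le> h (g x)}) []"
    by (rule often_uniform_graph_test) (blast intro: infinite_in_mono)
  with assms show False by (auto simp: H_iff)
qed

end

section \<open>Tests extracted from a coherent window\<close>

lemma Fin_pow_empty: "{} \<in> Fin_pow k"
  by (induction k rule: Fin_pow.induct) simp_all

lemma head_le_in_Fin_pow:
  "{t. length t = Suc k \<and> hd t \<le> c} \<in> Fin_pow (Suc k)"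
proof (cases k)
  case 0
  have "{t. length t = Suc 0 \<and> hd t \<le> c} = (\<lambda>n. [n]) ` {..c}"
    by (auto simp: length_Suc_conv image_iff)
  then show ?thesis using 0 by auto
next
  case (Suc j)
  have "{n. {t. length t = Suc j \<and> n \<le> c} \<notin> Fin_pow (Suc j)} \<subseteq> {..c}"
    using Fin_pow_empty[of "Suc j"] by (auto intro: ccontr)
  then show ?thesis using Suc by (auto intro: finite_subset)
qed

text \<open>Each section of the region below the graph of \<open>h\<close> bounds its own first coordinate, hence
  lies in the lower power.\<close>

lemma graph_in_Fin_pow:
  "{t. length t = Suc (Suc k) \<and> t ! 1 \<le> h (hd t)} \<in> Fin_pow (Suc (Suc k))"
proof -
  have "{t. length t = Suc k \<and> t ! 0 \<le> h n} \<in> Fin_pow (Suc k)" for n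
  proof -
    have "{t. length t = Suc k \<and> t ! 0 \<le> h n} = {t. length t = Suc k \<and> hd t \<le> h n}"
      by (auto simp: length_Suc_conv)
    then show ?thesis using head_le_in_Fin_pow by simp
  qed
  then show ?thesis by auto
qed

lemma window_Suc: "window \<xi> (Suc k) x = \<xi> (Suc k) x # window \<xi> k x"
  by (simp add: window_def)

lemma length_window: "length (window \<xi> k x) = k"
  by (simp add: window_def)

lemma coherent_window_head_test:
  assumes "coherent_window A N \<xi>" "1 \<le> k" "k \<le> N"
  shows "{x. \<xi> k x \<le> c} \<in> H_fin A"
proof -
  obtain j where k: "k = Suc j" using assms(2) by (cases k) auto
  have "window \<xi> k -` {t. length t = Suc j \<and> hd t \<le> c} \<in> H_fin A"
    using assms head_le_in_Fin_pow[of j c] k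
    unfolding coherent_window_def witnesses_Katetov_def by (metis atLeastAtMost_iff)
  then show ?thesis by (simp add: k window_Suc length_window vimage_def)
qed

lemma coherent_window_graph_test:
  assumes "coherent_window A N \<xi>" "1 \<le> k" "Suc k \<le> N"
  shows "{x. \<xi> k x \<le> h (\<xi> (Suc k) x)} \<in> H_fin A"
proof -
  obtain j where k: "k = Suc j" using assms(2) by (cases k) auto
  have "window \<xi> (Suc k) -` {t. length t = Suc (Suc j) \<and> t ! 1 \<le> h (hd t)} \<in> H_fin A"
    using assms graph_in_Fin_pow[of j h] k
    unfolding coherent_window_def witnesses_Katetov_def by (metis atLeastAtMost_iff le_SucI)
  then show ?thesis by (simp add: k window_Suc length_window vimage_def)
qed

text \<open>If the window had length \<open>m + 2\<close> or more, the sequence \<open>\<xi>\<^sub>2, \<dots>, \<xi>\<^sub>m\<^sub>+\<^sub>2\<close> would supply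
  exactly the \<open>m\<close> consecutive pairs needed to move the boundedness of \<open>\<xi>\<^sub>2\<close> on cells of level
  \<open>m\<close> up to the root.\<close>

lemma coherent_window_length_bound:
  assumes "tree_partition A"
    and coh: "coherent_window A N \<xi>"
    and tests: "\<And>h. {x. \<xi> 1 x \<le> h (\<xi> 2 x)} \<in> H A m"
  shows "N \<le> m + 1"
proof (rule ccontr)
  assume "\<not> N \<le> m + 1"
  then have N: "m + 2 \<le> N" by simp
  interpret tree_of_cells A by unfold_locales fact
  have "\<not> pos {x. \<xi> (k + 2) x \<le> h (\<xi> (Suc k + 2) x)} []" if "k < m" for k h
    using coherent_window_graph_test[OF coh, of "k + 2" h] N that by (simp add: H_fin_iff)
  moreover have "\<not> pos {x. \<xi> (m + 2) x \<le> c} []" for c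
    using coherent_window_head_test[OF coh, of "m + 2" c] N by (simp add: H_fin_iff)
  ultimately have "\<not> often m (\<lambda>t. pos UNIV t \<and> (\<exists>b. \<forall>x \<in> UNIV \<inter> A t. \<xi> (0 + 2) x \<le> b)) []"
    by (rule not_often_bounded)
  moreover have "often m (\<lambda>t. \<exists>b. \<forall>x \<in> A t. \<xi> 2 x \<le> b) []"
    using tests by (rule often_bounded_of_graph_tests)
  ultimately show False by (simp add: pos_UNIV numeral_2_eq_2)
qed

theorem theorem4p16:
  fixes A :: "nat list \<Rightarrow> nat set" and \<xi> :: "nat \<Rightarrow> nat \<Rightarrow> nat" and N m :: nat
  assumes "tree_partition A"
    and "N \<ge> 2"
    and "coherent_window A N \<xi>"
    and "m \<ge> 1"
    and "\<forall>h :: nat \<Rightarrow> nat. {x. \<xi> 1 x \<le> h (\<xi> 2 x)} \<in> H A m"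
  shows "N \<le> m + 1 \<and>
    \<not> (\<exists>\<eta> :: nat \<Rightarrow> nat \<Rightarrow> nat.
         \<eta> 1 = \<xi> 1 \<and> \<eta> 2 = \<xi> 2 \<and> coherent_window A (m + 2) \<eta>)"
proof
  show "N \<le> m + 1"
    using assms by (blast intro: coherent_window_length_bound)
  show "\<not> (\<exists>\<eta> :: nat \<Rightarrow> nat \<Rightarrow> nat.
         \<eta> 1 = \<xi> 1 \<and> \<eta> 2 = \<xi> 2 \<and> coherent_window A (m + 2) \<eta>)"
  proof
    assume "\<exists>\<eta> :: nat \<Rightarrow> nat \<Rightarrow> nat.
         \<eta> 1 = \<xi> 1 \<and> \<eta> 2 = \<xi> 2 \<and> coherent_window A (m + 2) \<eta>"
    then obtain \<eta> where "\<eta> 1 = \<xi> 1" "\<eta> 2 = \<xi> 2" "coherent_window A (m + 2) \<eta>" by blast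
    with assms have "m + 2 \<le> m + 1"
      by (intro coherent_window_length_bound[of A "m + 2" \<eta> m]) simp_all
    then show False by simp
  qed
qed

end
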